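(* Let $t\geq 1$ and let $G$ be a graph with the $t$-cleavage property. Let $T$ be the bipartite graph whose vertex classes are the set of $(t+1)$-blocks of $G$ and the set of $t$-vertex separators of $G$, in which a $(t+1)$-block $D$ and a $t$-vertex separator $X$ are adjacent if and only if $X\subseteq V(D)$. Then $T$ is a tree.
   Context: A $t$-vertex separator of a connected graph $G$ is a set $X\subseteq V(G)$ with $|X|=t$ such that $G-X$ is disconnected. $G$ has the $t$-cleavage property if $G$ is $t$-connected and every $t$-vertex separator of $G$ induces a complete subgraph (clique) of $G$. A $(t+1)$-block of such a $G$ is a subgraph $D$ which is either isomorphic to $K_{t+1}$ or $(t+1)$-connected, and which is maximal with respect to inclusion subject to this condition. *)

theory Defs
  imports "Graph_Theory.Graph_Theory"
begin

text \<open>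
  A simple graph, finite or infinite, is a pair digraph satisfying
  \<^locale>\<open>pair_bidirected_digraph\<close>: every undirected edge is represented by its two opposite arcs.
\<close>

definition delete_verts :: "('a, 'b) pre_digraph \<Rightarrow> 'a set \<Rightarrow> ('a, 'b) pre_digraph" where
  "delete_verts G X = G \<restriction> (verts G - X)"

text \<open>
  The library notion \<^const>\<open>connected\<close> fails for the graph without vertices, which is
  nevertheless not counted as disconnected.
\<close>

definition disconnected :: "('a, 'b) pre_digraph \<Rightarrow> bool" where
  "disconnected G \<longleftrightarrow> verts G \<noteq> {} \<and> \<not> connected G"

text \<open>
  The usual convention: a \<^term>\<open>k\<close>-connected graph has more than \<^term>\<open>k\<close> vertices,
  so the complete graph on \<^term>\<open>n\<close> vertices is (n-1)-connected but not n-connected.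
\<close>

definition k_connected :: "nat \<Rightarrow> ('a, 'b) pre_digraph \<Rightarrow> bool" where
  "k_connected k G \<longleftrightarrow>
     (infinite (verts G) \<or> k < card (verts G)) \<and>
     (\<forall>X. X \<subseteq> verts G \<and> finite X \<and> card X < k \<longrightarrow> connected (delete_verts G X))"

definition vertex_separator :: "nat \<Rightarrow> ('a, 'b) pre_digraph \<Rightarrow> 'a set \<Rightarrow> bool" where
  "vertex_separator t G X \<longleftrightarrow>
     X \<subseteq> verts G \<and> finite X \<and> card X = t \<and> disconnected (delete_verts G X)"

definition cleavage_property :: "nat \<Rightarrow> ('a, 'b) pre_digraph \<Rightarrow> bool" where
  "cleavage_property t G \<longleftrightarrow>
     k_connected t G \<and> (\<forall>X. vertex_separator t G X \<longrightarrow> complete_digraph t (G \<restriction> X))"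

text \<open>
  \<^term>\<open>block k G D\<close> says that \<^term>\<open>D\<close> is a k-block of \<^term>\<open>G\<close>. The symmetry condition
  restricts the subdigraphs considered by \<^const>\<open>pre_digraph.max_subgraph\<close> to undirected subgraphs.
\<close>

definition block :: "nat \<Rightarrow> 'a pair_pre_digraph \<Rightarrow> 'a pair_pre_digraph \<Rightarrow> bool" where
  "block k G D \<longleftrightarrow>
     pre_digraph.max_subgraph (with_proj G)
       (\<lambda>H. symmetric H \<and> (complete_digraph k H \<or> k_connected k H)) (with_proj D)"

definition block_separator_graph ::
    "nat \<Rightarrow> 'a pair_pre_digraph \<Rightarrow> ('a pair_pre_digraph + 'a set) pair_pre_digraph" where
  "block_separator_graph t G =
     \<lparr> pverts = Inl ` {D. block (t + 1) G D} \<union> Inr ` {X. vertex_separator t (with_proj G) X},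
       parcs = (\<Union>(D, X) \<in> {(D, X). block (t + 1) G D \<and> vertex_separator t (with_proj G) X
                                     \<and> X \<subseteq> pverts D}.
                  {(Inl D, Inr X), (Inr X, Inl D)}) \<rparr>"

text \<open>
  The library predicate \<^const>\<open>tree\<close> concerns directed cycles, and in a symmetric digraph every
  edge is a directed cycle of length 2. Undirected cycles are the directed ones of length at least 3.
\<close>

definition undirected_tree :: "'a pair_pre_digraph \<Rightarrow> bool" where
  "undirected_tree T \<longleftrightarrow>
     pair_bidirected_digraph T \<and> connected (with_proj T) \<and>
     \<not> (\<exists>p. pre_digraph.cycle (with_proj T) p \<and> 3 \<le> length p)"

end

theory Submission
  imports Defs
begin

text \<open>
  Call a vertex set inseparable if no \<open>t\<close>-vertex separator has two of its vertices in different
  components. Since separators are cliques, walks between vertices of a maximal inseparable set \<open>B\<close>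
  can be shortened until they stay in \<open>B\<close>; hence the \<open>(t+1)\<close>-blocks are exactly the graphs induced
  by the maximal inseparable sets with more than \<open>t\<close> vertices. Every separator \<open>X\<close> lies in a block
  reaching into any prescribed component \<open>C\<close> of \<open>G - X\<close>: a vertex of \<open>C\<close> with the fewest separators
  between itself and \<open>X\<close> has none, so that it extends \<open>X\<close> to an inseparable set. Only finitely many
  separators lie between two blocks, even if \<open>G\<close> is infinite, and cutting along one of them leaves
  fewer, which gives connectedness of the tree by induction. It has no cycle because two blocks that
  both contain \<open>X\<close> lie in different components of \<open>G - X\<close>, whereas a walk in the tree that avoids
  \<open>X\<close> never leaves a component of \<open>G - X\<close>.
\<close>

lemma ex_subset_card_Suc_iff: "(\<exists>A\<subseteq>B. card A = Suc n) \<longleftrightarrow> infinite B \<or> n < card B"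
proof
  assume "\<exists>A\<subseteq>B. card A = Suc n"
  then show "infinite B \<or> n < card B" by (metis Suc_le_eq card_mono)
next
  assume "infinite B \<or> n < card B"
  then show "\<exists>A\<subseteq>B. card A = Suc n"
    using infinite_arbitrarily_large obtain_subset_with_card_n by (metis Suc_leI)
qed

section \<open>Reachability inside a vertex set\<close>

lemma rtrancl_on_restrict: "rtrancl_on W (r \<inter> W \<times> W) = rtrancl_on W r"
proof -
  have "(u, v) \<in> rtrancl_on W (r \<inter> W \<times> W)" if "(u, v) \<in> rtrancl_on W r" for u v
    using that by (induct rule: rtrancl_on_induct) (auto intro: rtrancl_on_into_rtrancl_on)
  moreover have "(u, v) \<in> rtrancl_on W r" if "(u, v) \<in> rtrancl_on W (r \<inter> W \<times> W)" for u v
    using that by (rule rtrancl_on_mono[rotated 2]) auto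
  ultimately show ?thesis by auto
qed

lemma rtrancl_on_doubletonD:
  assumes "(u, v) \<in> rtrancl_on {u, v} r" "u \<noteq> v"
  shows "(u, v) \<in> r"
proof -
  have "z = v \<longrightarrow> (u, v) \<in> r" if "(u, z) \<in> rtrancl_on {u, v} r" for z
    using that by (induct rule: rtrancl_on_induct) (use assms(2) in auto)
  then show ?thesis using assms(1) by blast
qed

lemma rtrancl_on_finite_domain:
  assumes "(u, v) \<in> rtrancl_on W r"
  obtains P where "finite P" "P \<subseteq> W" "(u, v) \<in> rtrancl_on P r"
proof -
  have "\<exists>P. finite P \<and> P \<subseteq> W \<and> (u, v) \<in> rtrancl_on P r"
    using assms
  proof (induct rule: rtrancl_on_induct)
    case base
    then show ?case by (intro exI[of _ "{u}"]) auto
  next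
    case (step y z)
    then obtain P where P: "finite P" "P \<subseteq> W" "(u, y) \<in> rtrancl_on P r" by blast
    then have "(u, y) \<in> rtrancl_on (insert z P) r"
      by (blast intro: rtrancl_on_mono[of r r P])
    then have "(u, z) \<in> rtrancl_on (insert z P) r"
      using step by (blast intro: rtrancl_on_into_rtrancl_on)
    then show ?case using P step by (intro exI[of _ "insert z P"]) auto
  qed
  then show ?thesis using that by blast
qed

lemma rtrancl_on_stays_or_leaves:
  assumes "(a, b) \<in> rtrancl_on F r" "a \<in> W"
  obtains (stays) "(a, b) \<in> rtrancl_on (F \<inter> W) r"
  | (leaves) y z where "(a, y) \<in> rtrancl_on (F \<inter> W) r" "(y, z) \<in> r" "z \<in> F - W"
proof -
  have "(a, b) \<in> rtrancl_on (F \<inter> W) r \<or>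
    (\<exists>y z. (a, y) \<in> rtrancl_on (F \<inter> W) r \<and> (y, z) \<in> r \<and> z \<in> F - W)"
    using assms(1)
  proof (induct rule: rtrancl_on_induct)
    case base
    then show ?case using assms(2) by auto
  next
    case (step y z)
    then show ?case by (cases "z \<in> W") (blast intro: rtrancl_on_into_rtrancl_on)+
  qed
  then show ?thesis using that by blast
qed

lemma arcs_ends_induce_subgraph: "arcs_ends (H \<restriction> W) = arcs_ends H \<inter> W \<times> W"
  by (auto simp: arcs_ends_conv)

lemma symmetric_induce_subgraph: "symmetric H \<Longrightarrow> symmetric (H \<restriction> W)"
  by (auto simp: symmetric_def arcs_ends_induce_subgraph sym_def)

lemma delete_verts_induce_subgraph: "delete_verts (H \<restriction> W) S = H \<restriction> (W - S)"
  by (auto simp: delete_verts_def induce_subgraph_def)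

lemma connected_iff_rtrancl_on:
  assumes "wf_digraph H" "symmetric H"
  shows "connected H \<longleftrightarrow> verts H \<noteq> {} \<and>
    (\<forall>u \<in> verts H. \<forall>v \<in> verts H. (u, v) \<in> rtrancl_on (verts H) (arcs_ends H))"
  using wf_digraph.adj_mk_symmetric_eq[OF assms]
  by (simp add: connected_def strongly_connected_def reachable_def)

lemma connected_induce_subgraph_iff:
  assumes "wf_digraph H" "symmetric H"
  shows "connected (H \<restriction> W) \<longleftrightarrow>
    W \<noteq> {} \<and> (\<forall>u \<in> W. \<forall>v \<in> W. (u, v) \<in> rtrancl_on W (arcs_ends H))"
  using connected_iff_rtrancl_on[OF wf_digraph.wellformed_induce_subgraph[OF assms(1)]
      symmetric_induce_subgraph[OF assms(2)], of W]
  by (simp add: arcs_ends_induce_subgraph rtrancl_on_restrict)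

lemma subgraph_induce_subgraphI_superset:
  assumes "subgraph H K" "verts H \<subseteq> W"
  shows "subgraph H (K \<restriction> W)"
  using assms
  by (fastforce simp: subgraph_def compatible_def wf_digraph.wellformed_induce_subgraph
      dest: wf_digraph.wellformed)

lemma subgraph_antisym: "subgraph H K \<Longrightarrow> subgraph K H \<Longrightarrow> H = K"
  by (auto simp: subgraph_def compatible_def)

lemma with_proj_inject: "with_proj G = with_proj H \<longleftrightarrow> G = H"
  by (cases G, cases H) (auto simp: with_proj_def)

context pair_bidirected_digraph
begin

abbreviation linked :: "'a set \<Rightarrow> 'a rel" where
  "linked S \<equiv> rtrancl_on (pverts G - S) (parcs G)"

lemma linked_in_verts: "(u, v) \<in> linked S \<Longrightarrow> u \<in> pverts G - S \<and> v \<in> pverts G - S"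
  by (blast dest: in_rtrancl_on_in_F)

lemma rtrancl_on_arcs_sym:
  "(u, v) \<in> rtrancl_on W (parcs G) \<Longrightarrow> (v, u) \<in> rtrancl_on W (parcs G)"
  using arcs_symmetric rtrancl_on_sym by (metis symI symD)

lemma linked_sym: "(u, v) \<in> linked S \<Longrightarrow> (v, u) \<in> linked S"
  by (rule rtrancl_on_arcs_sym)

lemma linked_trans: "(u, v) \<in> linked S \<Longrightarrow> (v, w) \<in> linked S \<Longrightarrow> (u, w) \<in> linked S"
  by (rule rtrancl_on_trans)

lemma linked_edge: "(u, v) \<in> parcs G \<Longrightarrow> u \<notin> S \<Longrightarrow> v \<notin> S \<Longrightarrow> (u, v) \<in> linked S"
  using in_arcsD1 in_arcsD2 by (blast intro: rtrancl_on_into_rtrancl_on)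

lemma linked_avoiding:
  assumes "(u, v) \<in> linked Y" "\<And>x. x \<in> X \<Longrightarrow> (u, x) \<notin> linked Y"
  shows "(u, v) \<in> linked X"
proof -
  have "(u, u) \<in> linked Y" using assms(1) linked_in_verts by blast
  then have "u \<in> - X" using assms(2) by blast
  with assms(1) show ?thesis
  proof (cases rule: rtrancl_on_stays_or_leaves)
    case stays
    then show ?thesis by (rule rtrancl_on_mono[rotated 2]) auto
  next
    case (leaves y z)
    then have "(u, y) \<in> linked Y" by (auto intro: rtrancl_on_mono[rotated 2])
    then have "(u, z) \<in> linked Y" using leaves by (blast intro: rtrancl_on_into_rtrancl_on)
    then show ?thesis using assms(2) leaves(3) by blast
  qed
qed

lemma linked_through_component:
  assumes "(w, x) \<in> linked (X - {x})" "w \<notin> X" "x \<in> X"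
  shows "(w, x) \<in> rtrancl_on (insert x (linked X `` {w})) (parcs G)"
proof -
  let ?C = "linked X `` {w}"
  have "w \<in> ?C" using assms linked_in_verts by blast
  with assms(1) show ?thesis
  proof (cases rule: rtrancl_on_stays_or_leaves)
    case stays
    then have "x \<in> ?C" by (blast dest: in_rtrancl_on_in_F)
    then show ?thesis using assms(3) linked_in_verts by blast
  next
    case (leaves y z)
    then have "(w, y) \<in> linked X" by (blast dest: in_rtrancl_on_in_F)
    then have "z = x" using leaves(2,3) by (blast intro: rtrancl_on_into_rtrancl_on)
    moreover have "(w, y) \<in> rtrancl_on (insert x ?C) (parcs G)"
      using leaves(1) by (rule rtrancl_on_mono[rotated 2]) auto
    ultimately show ?thesis using leaves(2) by (blast intro: rtrancl_on_into_rtrancl_on)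
  qed
qed

lemma connected_delete_verts_iff:
  "connected (delete_verts (with_proj G) S) \<longleftrightarrow>
    pverts G - S \<noteq> {} \<and> (\<forall>u \<in> pverts G - S. \<forall>v \<in> pverts G - S. (u, v) \<in> linked S)"
  using connected_induce_subgraph_iff[OF wf_digraph_axioms pair_sym_arcs, of "pverts G - S"]
  by (simp add: delete_verts_def)

lemma awalk_imp_linked:
  assumes "awalk u p v" "set (pawalk_verts u p) \<inter> S = {}"
  shows "(u, v) \<in> linked S"
  using assms
proof (induct p arbitrary: u)
  case Nil
  then show ?case by (auto simp: awalk_Nil_iff)
next
  case (Cons e p)
  then have "(u, snd e) \<in> parcs G" "u \<in> pverts G - S" and "(snd e, v) \<in> linked S"
    by (auto simp: awalk_Cons_iff in_arcsD1)
  then show ?case by (blast intro: converse_rtrancl_on_into_rtrancl_on)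
qed

lemma rotate_cycleE:
  assumes "cycle p" "x \<in> snd ` set p"
  obtains q where "awalk x q x" "distinct (map snd q)" "length q = length p"
proof -
  obtain u where u: "awalk u p u" "distinct (tl (pawalk_verts u p))" "p \<noteq> []"
    using assms(1) by (auto simp: cycle_def)
  have verts: "pawalk_verts u p = fst (hd p) # map snd p"
    using u awalk_verts_conv'[of u p u] by (auto simp: awalk_def)
  then have "x \<in> set (pawalk_verts u p)" using assms(2) by auto
  with u(1) obtain q r where "p = q @ r" "awalk x (r @ q) x" by (rule rotate_awalkE)
  then show ?thesis using that[of "r @ q"] u(2) verts by auto
qed

lemma cycle_neighbours_linked:
  assumes "cycle p" "3 \<le> length p" "x \<in> snd ` set p"
  obtains a b where "(x, a) \<in> parcs G" "(x, b) \<in> parcs G" "a \<noteq> b" "(a, b) \<in> linked {x}"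
proof -
  obtain p' where p': "awalk x p' x" "distinct (map snd p')" "3 \<le> length p'"
    using rotate_cycleE[OF assms(1,3)] assms(2) by metis
  obtain a q where p'_Cons: "p' = (x, a) # q"
    and q: "awalk a q x" "(x, a) \<in> parcs G" "2 \<le> length q"
    using p'(1,3) by (cases p') (auto simp: awalk_Cons_iff)
  obtain q' b where q_snoc: "q = q' @ [(b, x)]" and q': "awalk a q' b" "(b, x) \<in> parcs G"
    using q(1,3) by (cases q rule: rev_cases) (auto simp: awalk_simps)
  have "q' \<noteq> []" using q(3) q_snoc by auto
  have verts: "pawalk_verts a q' = a # map snd q'"
    using q'(1) awalk_verts_conv'[of a q' b] by (cases q') (auto simp: awalk_def)
  have dist: "distinct (a # map snd q' @ [x])" using p'(2) p'_Cons q_snoc by simp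
  have "b \<in> snd ` set q'"
    using q'(1) \<open>q' \<noteq> []\<close> by (cases q' rule: rev_cases) (auto simp: awalk_simps)
  then have "a \<noteq> b" using dist by auto
  moreover have "(a, b) \<in> linked {x}"
    using q'(1) verts dist by (intro awalk_imp_linked) auto
  ultimately show ?thesis using that q(2) q'(2) arcs_symmetric by blast
qed

definition induced :: "'a set \<Rightarrow> 'a pair_pre_digraph" where
  "induced B = \<lparr> pverts = B, parcs = parcs G \<inter> B \<times> B \<rparr>"

lemma pverts_induced [simp]: "pverts (induced B) = B"
  by (simp add: induced_def)

lemma with_proj_induced: "with_proj (induced B) = with_proj G \<restriction> B"
  by (auto simp: with_proj_def induced_def induce_subgraph_def)

end

section \<open>Separators and inseparable sets\<close>

locale cleavage_graph = pair_bidirected_digraph G for G :: "'a pair_pre_digraph" +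
  fixes t :: nat
  assumes cleavage: "cleavage_property t (with_proj G)"
begin

abbreviation V :: "'a set" where "V \<equiv> pverts G"
abbreviation E :: "'a rel" where "E \<equiv> parcs G"
abbreviation separator :: "'a set \<Rightarrow> bool" where
  "separator X \<equiv> vertex_separator t (with_proj G) X"

lemma separatorD:
  assumes "separator X"
  shows "X \<subseteq> V" "finite X" "card X = t"
  using assms by (auto simp: vertex_separator_def)

lemma separator_proper:
  assumes "separator X"
  obtains c where "c \<in> V - X"
  using assms by (auto simp: vertex_separator_def disconnected_def delete_verts_def)

lemma subset_separator_eq:
  assumes "separator X" "S \<subseteq> X" "card S = t"
  shows "S = X"
  using assms separatorD card_subset_eq by metis

lemma separator_clique:
  assumes "separator X" "x \<in> X" "y \<in> X" "x \<noteq> y"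
  shows "(x, y) \<in> E"
proof -
  have "arcs_ends (with_proj G \<restriction> X) = {(u, v). (u, v) \<in> X \<times> X \<and> u \<noteq> v}"
    using assms cleavage by (simp add: cleavage_property_def complete_digraph_def)
  then show ?thesis using assms by (auto simp: arcs_ends_induce_subgraph)
qed

lemma linked_if_card_less:
  assumes "S \<subseteq> V" "finite S" "card S < t" "u \<in> V - S" "v \<in> V - S"
  shows "(u, v) \<in> linked S"
  using assms cleavage connected_delete_verts_iff[of S]
  by (auto simp: cleavage_property_def k_connected_def)

lemma linked_if_not_separator:
  assumes "S \<subseteq> V" "finite S" "card S \<le> t" "\<not> separator S" "u \<in> V - S" "v \<in> V - S"
  shows "(u, v) \<in> linked S"
proof (cases "card S < t")
  case True
  then show ?thesis using linked_if_card_less assms by blast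
next
  case False
  then have "\<not> disconnected (delete_verts (with_proj G) S)"
    using assms by (auto simp: vertex_separator_def)
  moreover have "verts (delete_verts (with_proj G) S) \<noteq> {}"
    using assms by (auto simp: delete_verts_def)
  ultimately show ?thesis
    using assms connected_delete_verts_iff[of S] by (auto simp: disconnected_def)
qed

definition separators_between :: "'a set \<Rightarrow> 'a set \<Rightarrow> 'a set set" where
  "separators_between A B = {X. separator X \<and> (\<exists>u \<in> A - X. \<exists>v \<in> B - X. (u, v) \<notin> linked X)}"

definition inseparable :: "'a set \<Rightarrow> bool" where
  "inseparable B \<longleftrightarrow> B \<subseteq> V \<and> separators_between B B = {}"

lemma separators_between_separator: "X \<in> separators_between A B \<Longrightarrow> separator X"
  by (simp add: separators_between_def)

lemma separators_between_commute: "separators_between A B = separators_between B A"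
  using linked_sym unfolding separators_between_def by blast

lemma separators_between_eq_UN:
  "separators_between A B = (\<Union>u \<in> A. \<Union>v \<in> B. separators_between {u} {v})"
  by (auto simp: separators_between_def)

lemma inseparable_linked:
  assumes "inseparable B" "separator X" "u \<in> B - X" "v \<in> B - X"
  shows "(u, v) \<in> linked X"
  using assms by (auto simp: inseparable_def separators_between_def)

lemma inseparable_subset: "inseparable B \<Longrightarrow> A \<subseteq> B \<Longrightarrow> inseparable A"
  unfolding inseparable_def separators_between_def by blast

lemma inseparable_singleton: "v \<in> V \<Longrightarrow> inseparable {v}"
  by (auto simp: inseparable_def separators_between_def)

lemma inseparable_clique:
  assumes "B \<subseteq> V" "\<And>x y. x \<in> B \<Longrightarrow> y \<in> B \<Longrightarrow> x \<noteq> y \<Longrightarrow> (x, y) \<in> E"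
  shows "inseparable B"
proof -
  have "(u, v) \<in> linked X" if "u \<in> B - X" "v \<in> B - X" for X u v
    using that assms linked_edge by (cases "u = v") auto
  then show ?thesis using assms(1) by (auto simp: inseparable_def separators_between_def)
qed

lemma separator_inseparable: "separator X \<Longrightarrow> inseparable X"
  using separator_clique separatorD(1) by (intro inseparable_clique) auto

lemma separators_between_not_linked:
  assumes "inseparable A" "inseparable B" "X \<in> separators_between A B" "u \<in> A" "v \<in> B"
  shows "(u, v) \<notin> linked X"
proof
  assume uv: "(u, v) \<in> linked X"
  then have notin: "u \<notin> X" "v \<notin> X" using linked_in_verts by auto
  obtain u' v' where separated: "separator X" "u' \<in> A - X" "v' \<in> B - X" "(u', v') \<notin> linked X"
    using assms(3) by (auto simp: separators_between_def)
  have "(u', u) \<in> linked X" "(v, v') \<in> linked X"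
    using assms notin separated by (auto intro: inseparable_linked)
  then show False using uv separated linked_trans by blast
qed

lemma separators_between_adjacent:
  assumes "X \<in> separators_between {w} B" "(w, w') \<in> E" "w' \<notin> X"
  shows "X \<in> separators_between {w'} B"
proof -
  have "w \<notin> X" using assms(1) by (auto simp: separators_between_def)
  then have "(w, w') \<in> linked X" using assms(2,3) by (intro linked_edge)
  then show ?thesis using assms(1,3) linked_trans unfolding separators_between_def by blast
qed

lemma separators_between_meet_walk:
  assumes "X \<in> separators_between {u} {v}" "(u, v) \<in> rtrancl_on P E" "P \<subseteq> V"
  shows "P \<inter> X \<noteq> {}"
proof
  assume "P \<inter> X = {}"
  then have "(u, v) \<in> linked X"
    using assms(3) by (intro rtrancl_on_mono[OF subset_refl _ assms(2)]) auto
  then show False using assms(1) by (auto simp: separators_between_def)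
qed

lemma linked_other_separator:
  assumes sep: "separator Y" "separator Z"
    and xy: "(x, y) \<in> linked Y" and w: "w \<in> Z - Y" "(x, w) \<notin> linked Y"
  shows "(x, y) \<in> linked Z"
  using xy
proof (rule linked_avoiding)
  fix p assume "p \<in> Z"
  show "(x, p) \<notin> linked Y"
  proof
    assume xp: "(x, p) \<in> linked Y"
    then have "(p, w) \<in> linked Y"
      using inseparable_linked[OF separator_inseparable sep(1)] sep(2) \<open>p \<in> Z\<close> w(1)
        linked_in_verts by blast
    then show False using xp w(2) linked_trans by blast
  qed
qed

lemma inseparable_UnI:
  assumes "inseparable A" "inseparable B" "separators_between A B = {}"
  shows "inseparable (A \<union> B)"
proof -
  have "separators_between (A \<union> B) (A \<union> B) = separators_between A A \<union> separators_between B B \<union>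
    separators_between A B \<union> separators_between B A"
    by (auto simp: separators_between_def)
  then show ?thesis
    using assms separators_between_commute[of B A] by (simp add: inseparable_def)
qed

definition max_inseparable :: "'a set \<Rightarrow> bool" where
  "max_inseparable B \<longleftrightarrow> inseparable B \<and> (\<forall>B'. inseparable B' \<and> B \<subseteq> B' \<longrightarrow> B' = B)"

lemma max_inseparable_imp_inseparable: "max_inseparable B \<Longrightarrow> inseparable B"
  by (simp add: max_inseparable_def)

lemma separators_between_max_inseparable:
  assumes "max_inseparable B" "inseparable A" "\<not> A \<subseteq> B"
  shows "separators_between A B \<noteq> {}"
proof
  assume "separators_between A B = {}"
  then have "inseparable (A \<union> B)"
    using assms by (intro inseparable_UnI) (auto simp: max_inseparable_def)
  then show False using assms(1,3) unfolding max_inseparable_def by blast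
qed

lemma separators_between_neighbour_of_max_inseparable:
  assumes "max_inseparable B" "u \<in> B" "(u, w) \<in> E" "w \<notin> B"
  obtains X where "X \<in> separators_between {w} B" "u \<in> X"
proof -
  have w: "inseparable {w}" using assms(3) by (blast intro: inseparable_singleton in_arcsD2)
  then obtain X where X: "X \<in> separators_between {w} B"
    using separators_between_max_inseparable[OF assms(1)] assms(4) by blast
  then have "w \<notin> X" by (auto simp: separators_between_def)
  moreover have "(w, u) \<notin> linked X"
    using separators_between_not_linked[OF w max_inseparable_imp_inseparable[OF assms(1)] X]
      assms(2) by blast
  ultimately have "u \<in> X" using assms(3) linked_edge linked_sym by blast
  then show ?thesis using that X by blast
qed

lemma inseparable_Union_chain:
  assumes "subset.chain (Collect inseparable) \<C>"
  shows "inseparable (\<Union>\<C>)"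
proof -
  have inseparable: "inseparable B" if "B \<in> \<C>" for B
    using that assms by (auto simp: subset.chain_def)
  have "(u, v) \<in> linked X" if X: "separator X" and uv: "u \<in> \<Union>\<C> - X" "v \<in> \<Union>\<C> - X" for X u v
  proof -
    obtain B where "B \<in> \<C>" "u \<in> B" "v \<in> B"
      using uv assms unfolding subset.chain_def by blast
    then show ?thesis using X uv by (auto intro: inseparable_linked[OF inseparable])
  qed
  moreover have "\<Union>\<C> \<subseteq> V" using inseparable by (auto simp: inseparable_def)
  ultimately show ?thesis by (auto simp: inseparable_def separators_between_def)
qed

lemma max_inseparable_extend:
  assumes "inseparable A"
  obtains B where "A \<subseteq> B" "max_inseparable B"
proof -
  let ?F = "{B. inseparable B \<and> A \<subseteq> B}"
  have "\<exists>M \<in> ?F. \<forall>X \<in> ?F. M \<subseteq> X \<longrightarrow> X = M"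
  proof (rule subset_Zorn_nonempty)
    show "?F \<noteq> {}" using assms by blast
  next
    fix \<C> assume nonempty: "\<C> \<noteq> {}" and chain: "subset.chain ?F \<C>"
    have "A \<subseteq> B" if "B \<in> \<C>" for B using that chain by (auto simp: subset.chain_def)
    then have "A \<subseteq> \<Union>\<C>" using nonempty by blast
    moreover have "inseparable (\<Union>\<C>)"
      using chain by (intro inseparable_Union_chain) (auto simp: subset.chain_def)
    ultimately show "\<Union>\<C> \<in> ?F" by blast
  qed
  then obtain M where M: "M \<in> ?F" "\<forall>X \<in> ?F. M \<subseteq> X \<longrightarrow> X = M" ..
  then have "max_inseparable M" unfolding max_inseparable_def by (simp add: order_trans[of A M])
  then show ?thesis using that M(1) by blast
qed

text \<open>
  A walk that leaves \<open>B\<close> from \<open>u\<close> to \<open>w\<close> returns to \<open>B\<close> only through a separator \<open>X\<close> of \<open>w\<close> and \<open>B\<close>,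
  which contains \<open>u\<close>. As \<open>X\<close> is a clique, the walk may skip from \<open>u\<close> to its next vertex in \<open>X\<close>.
\<close>

lemma max_inseparable_shortcut:
  assumes "max_inseparable B" "v \<in> B" "(w, v) \<in> linked S"
  shows "(w \<in> B \<longrightarrow> (w, v) \<in> rtrancl_on (B - S) E) \<and>
    (\<forall>X \<in> separators_between {w} B. \<forall>u \<in> X \<inter> B - S. (u, v) \<in> rtrancl_on (B - S) E)"
  using assms(3)
proof (induct rule: converse_rtrancl_on_induct)
  case base
  have "separators_between {v} B = {}"
    using max_inseparable_imp_inseparable[OF assms(1)] assms(2)
    by (auto simp: inseparable_def separators_between_def)
  then show ?case using base assms(2) by auto
next
  case (step w w')
  note IH = step.hyps(5)
  have via_neighbour: "(u, v) \<in> rtrancl_on (B - S) E" if u: "u \<in> B - S" "(u, w') \<in> E" for u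
  proof (cases "w' \<in> B")
    case True
    then show ?thesis using IH u by (blast intro: converse_rtrancl_on_into_rtrancl_on)
  next
    case False
    then obtain X where "X \<in> separators_between {w'} B" "u \<in> X"
      using separators_between_neighbour_of_max_inseparable[OF assms(1)] u by blast
    then show ?thesis using IH u by blast
  qed
  have "(u, v) \<in> rtrancl_on (B - S) E"
    if X: "X \<in> separators_between {w} B" and u: "u \<in> X \<inter> B - S" for X u
  proof (cases "w' \<in> X")
    case True
    then show ?thesis
      using via_neighbour IH u separator_clique separators_between_separator[OF X]
      by (cases "u = w'") auto
  next
    case False
    then show ?thesis
      using IH separators_between_adjacent[OF X step.hyps(1)] u by blast
  qed
  then show ?case using via_neighbour step.hyps(1,3) by blast
qed

lemma max_inseparable_connected:
  assumes "max_inseparable B" "S \<subseteq> B" "finite S" "card S \<le> t" "u \<in> B - S" "v \<in> B - S"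
  shows "(u, v) \<in> rtrancl_on (B - S) E"
proof -
  have B: "inseparable B" using assms(1) by (rule max_inseparable_imp_inseparable)
  then have "B \<subseteq> V" by (simp add: inseparable_def)
  have "(u, v) \<in> linked S"
  proof (cases "separator S")
    case True
    then show ?thesis using B assms by (auto intro: inseparable_linked)
  next
    case False
    then show ?thesis using assms \<open>B \<subseteq> V\<close> by (intro linked_if_not_separator) auto
  qed
  then show ?thesis using max_inseparable_shortcut[OF assms(1)] assms(5,6) by blast
qed

lemma max_inseparable_card_Suc_clique:
  assumes "max_inseparable B" "finite B" "card B = Suc t" "u \<in> B" "v \<in> B" "u \<noteq> v"
  shows "(u, v) \<in> E"
proof -
  have "card (B - {u, v}) \<le> t" using assms by (simp add: card_Diff_subset)
  then have "(u, v) \<in> rtrancl_on (B - (B - {u, v})) E"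
    using assms by (intro max_inseparable_connected) auto
  moreover have "B - (B - {u, v}) = {u, v}" using assms by blast
  ultimately show ?thesis using assms(6) by (simp add: rtrancl_on_doubletonD)
qed

section \<open>Extending a separator into a component\<close>

text \<open>
  A set \<open>S\<close> of fewer than \<open>t\<close> vertices does not separate \<open>u\<close> from \<open>v\<close>, so every separator of \<open>u\<close>
  and \<open>v\<close> that contains \<open>S\<close> also contains one of the finitely many vertices of a walk avoiding \<open>S\<close>.
\<close>

lemma finite_separators_between_containing:
  assumes "u \<in> V" "v \<in> V" "S \<subseteq> V" "finite S" "card S \<le> t"
  shows "finite {Y \<in> separators_between {u} {v}. S \<subseteq> Y}"
  using assms(3-)
proof (induct "t - card S" arbitrary: S)
  case 0
  then have "card S = t" by simp
  then have "{Y \<in> separators_between {u} {v}. S \<subseteq> Y} \<subseteq> {S}"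
    using subset_separator_eq separators_between_separator by blast
  then show ?case by (rule finite_subset) simp
next
  case (Suc k)
  show ?case
  proof (cases "u \<in> S \<or> v \<in> S")
    case True
    then have "{Y \<in> separators_between {u} {v}. S \<subseteq> Y} = {}"
      by (auto simp: separators_between_def)
    then show ?thesis by (simp only: finite.emptyI)
  next
    case False
    then have "(u, v) \<in> linked S" using Suc assms by (intro linked_if_card_less) auto
    then obtain P where P: "finite P" "P \<subseteq> V - S" "(u, v) \<in> rtrancl_on P E"
      by (rule rtrancl_on_finite_domain)
    then have "P \<inter> Y \<noteq> {}" if "Y \<in> separators_between {u} {v}" for Y
      using separators_between_meet_walk that by blast
    then have "{Y \<in> separators_between {u} {v}. S \<subseteq> Y} \<subseteq>
        (\<Union>p \<in> P. {Y \<in> separators_between {u} {v}. insert p S \<subseteq> Y})"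
      by fastforce
    moreover have "finite {Y \<in> separators_between {u} {v}. insert p S \<subseteq> Y}" if "p \<in> P" for p
    proof (rule Suc.hyps(1))
      have "p \<in> V - S" using that P(2) by blast
      then show "k = t - card (insert p S)" "insert p S \<subseteq> V" "finite (insert p S)"
        "card (insert p S) \<le> t"
        using Suc.hyps(2) Suc.prems by auto
    qed
    ultimately show ?thesis using P(1) by (meson finite_UN finite_subset)
  qed
qed

lemma finite_separators_between:
  assumes "finite A" "finite B" "A \<subseteq> V" "B \<subseteq> V"
  shows "finite (separators_between A B)"
proof -
  have "finite (separators_between {u} {v})" if "u \<in> V" "v \<in> V" for u v
    using finite_separators_between_containing[OF that, of "{}"] by simp
  then show ?thesis
    using assms by (subst separators_between_eq_UN) (blast intro: finite_UN_I)
qed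

text \<open>
  Replace \<open>w\<close> by a vertex \<open>z\<close> at which a separator \<open>Y\<close> of \<open>w\<close> and \<open>X\<close> borders on the component of
  \<open>G - Y\<close> meeting \<open>X\<close>. No separator is gained: one that contains \<open>w\<close> is a clique and hence misses
  that component, so it cannot cut \<open>z\<close> off from \<open>X\<close>.
\<close>

lemma separators_between_subset_at_border:
  assumes X: "inseparable X" and w: "w \<in> V" and Y: "Y \<in> separators_between {w} X"
    and z: "z \<in> Y" and x: "x \<in> X" "(x, y) \<in> linked Y" "(y, z) \<in> E"
  shows "separators_between {z} X \<subseteq> separators_between {w} X"
proof
  fix Z assume Z: "Z \<in> separators_between {z} X"
  have sep: "separator Y" "separator Z" using Y Z by (auto dest: separators_between_separator)
  have "z \<in> V" using x(3) by (rule in_arcsD2)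
  have not_linked_Y: "(w, x') \<notin> linked Y" if "x' \<in> X" for x'
    using separators_between_not_linked[OF inseparable_singleton[OF w] X Y] that by blast
  have not_linked_Z: "(z, x') \<notin> linked Z" if "x' \<in> X" for x'
    using separators_between_not_linked[OF inseparable_singleton[OF \<open>z \<in> V\<close>] X Z] that by blast
  have "w \<notin> Y" "z \<notin> Z" using Y Z by (auto simp: separators_between_def)
  have "w \<notin> Z"
  proof
    assume "w \<in> Z"
    then have "(x, y) \<in> linked Z"
      using linked_other_separator[OF sep x(2)] \<open>w \<notin> Y\<close> not_linked_Y x(1) linked_sym by blast
    then have "(x, z) \<in> linked Z"
      using x(3) \<open>z \<in> V\<close> \<open>z \<notin> Z\<close> by (blast intro: rtrancl_on_into_rtrancl_on)
    then show False using not_linked_Z x(1) linked_sym by blast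
  qed
  moreover obtain x' where x': "x' \<in> X - Z" using Z by (auto simp: separators_between_def)
  moreover have "(w, x') \<notin> linked Z"
  proof
    assume wx': "(w, x') \<in> linked Z"
    then have "(w, z) \<notin> linked Z" using not_linked_Z x' linked_trans linked_sym by blast
    then have "(w, x') \<in> linked Y"
      using linked_other_separator[OF sep(2,1) wx'] z \<open>z \<notin> Z\<close> by blast
    then show False using not_linked_Y x' by blast
  qed
  ultimately show "Z \<in> separators_between {w} X"
    using sep(2) by (auto simp: separators_between_def)
qed

lemma fewer_separators_between:
  assumes X: "separator X" and w: "w \<in> V - X" and Y: "Y \<in> separators_between {w} X"
  obtains z where "(w, z) \<in> linked X" "separators_between {z} X \<subset> separators_between {w} X"
proof -
  let ?C = "linked X `` {w}"
  obtain x where x: "x \<in> X - Y" "(w, x) \<notin> linked Y"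
    using Y by (auto simp: separators_between_def)
  have off_Y: "insert x ?C \<inter> - Y \<subseteq> V - Y"
    using x(1) separatorD(1)[OF X] linked_in_verts by auto
  have "card (X - {x}) < t" using separatorD(2,3)[OF X] x(1) card_Diff1_less[of X x] by auto
  then have "(w, x) \<in> linked (X - {x})"
    using separatorD[OF X] x(1) w by (intro linked_if_card_less) auto
  then have "(w, x) \<in> rtrancl_on (insert x ?C) E"
    using w x(1) by (intro linked_through_component) auto
  then have "(x, w) \<in> rtrancl_on (insert x ?C) E" by (rule rtrancl_on_arcs_sym)
  moreover have "x \<in> - Y" using x(1) by blast
  ultimately obtain y z where yz: "(x, y) \<in> linked Y" "(y, z) \<in> E" "z \<in> Y \<inter> insert x ?C"
  proof (cases rule: rtrancl_on_stays_or_leaves)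
    case stays
    then have "(x, w) \<in> linked Y" by (rule rtrancl_on_mono[OF subset_refl off_Y])
    then show ?thesis using x(2) linked_sym by blast
  next
    case (leaves y z)
    from leaves(1) have "(x, y) \<in> linked Y" by (rule rtrancl_on_mono[OF subset_refl off_Y])
    then show ?thesis using that leaves(2,3) by blast
  qed
  then have "separators_between {z} X \<subseteq> separators_between {w} X"
    using separators_between_subset_at_border[OF separator_inseparable[OF X] _ Y] w x(1) yz
    by blast
  moreover have "Y \<notin> separators_between {z} X" using yz(3) by (auto simp: separators_between_def)
  ultimately show ?thesis using that yz(3) x(1) Y by blast
qed

lemma separator_extends_into_component:
  assumes "separator X" "c \<in> V - X"
  obtains w where "(c, w) \<in> linked X" "inseparable (insert w X)"
proof -
  have "\<exists>w. (c, w) \<in> linked X \<and> inseparable (insert w X)"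
    using assms(2)
  proof (induct "card (separators_between {c} X)" arbitrary: c rule: less_induct)
    case less
    show ?case
    proof (cases "separators_between {c} X = {}")
      case True
      then have "inseparable ({c} \<union> X)"
        using less.prems inseparable_singleton separator_inseparable[OF assms(1)]
        by (intro inseparable_UnI) auto
      then show ?thesis using less.prems by auto
    next
      case False
      then obtain z where z: "(c, z) \<in> linked X"
        "separators_between {z} X \<subset> separators_between {c} X"
        using fewer_separators_between[OF assms(1) less.prems] by blast
      have "finite (separators_between {c} X)"
        using less.prems separatorD[OF assms(1)] by (intro finite_separators_between) auto
      then have "card (separators_between {z} X) < card (separators_between {c} X)"
        using z(2) by (rule psubset_card_mono)
      then obtain w where w: "(z, w) \<in> linked X" "inseparable (insert w X)"
        using less.hyps linked_in_verts[OF z(1)] by metis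
      then show ?thesis using linked_trans[OF z(1)] by blast
    qed
  qed
  then show ?thesis using that by blast
qed

section \<open>Vertex sets of blocks\<close>

definition block_verts :: "'a set \<Rightarrow> bool" where
  "block_verts B \<longleftrightarrow> max_inseparable B \<and> (infinite B \<or> t < card B)"

lemma block_vertsD:
  assumes "block_verts B"
  shows "max_inseparable B" "inseparable B" "B \<subseteq> V"
  using assms by (auto simp: block_verts_def max_inseparable_def inseparable_def)

lemma separators_between_block_verts_nonempty:
  assumes "block_verts B" "block_verts B'" "B \<noteq> B'"
  shows "separators_between B B' \<noteq> {}"
proof (rule separators_between_max_inseparable)
  show "max_inseparable B'" "inseparable B" using assms block_vertsD by auto
  then show "\<not> B \<subseteq> B'"
    using block_vertsD(1)[OF assms(1)] assms(3) by (auto simp: max_inseparable_def)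
qed

lemma block_verts_extend:
  assumes "inseparable A" "infinite A \<or> t < card A"
  obtains B where "A \<subseteq> B" "block_verts B"
proof -
  obtain B where B: "A \<subseteq> B" "max_inseparable B" using max_inseparable_extend[OF assms(1)] .
  then have "infinite B \<or> t < card B"
    using assms(2) unfolding ex_subset_card_Suc_iff[symmetric] by blast
  then show ?thesis using that B by (simp add: block_verts_def)
qed

lemma not_subset_separator:
  assumes "infinite A \<or> t < card A" "separator X"
  shows "\<not> A \<subseteq> X"
  using assms separatorD(2,3) card_mono finite_subset by (metis leD)

lemma block_verts_not_subset_separator: "block_verts B \<Longrightarrow> separator X \<Longrightarrow> \<not> B \<subseteq> X"
  by (simp add: block_verts_def not_subset_separator)

lemma block_verts_finite_witness:
  assumes "block_verts B"
  obtains A where "A \<subseteq> B" "finite A"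
    "\<forall>C. inseparable C \<longrightarrow> separators_between B C \<subseteq> separators_between A C"
proof -
  obtain A where A: "A \<subseteq> B" "card A = Suc t"
    using assms ex_subset_card_Suc_iff[of B t] by (auto simp: block_verts_def)
  have "X \<in> separators_between A C"
    if C: "inseparable C" and X: "X \<in> separators_between B C" for C X
  proof -
    have sep: "separator X" using X by (rule separators_between_separator)
    then obtain a where "a \<in> A - X" using not_subset_separator[of A X] A(2) by auto
    moreover obtain c where "c \<in> C - X" using X by (auto simp: separators_between_def)
    ultimately show ?thesis
      using separators_between_not_linked[OF block_vertsD(2)[OF assms] C X, of a c] A(1) sep
      by (auto simp: separators_between_def)
  qed
  moreover have "finite A" using A(2) card.infinite by fastforce
  ultimately show ?thesis using that[OF A(1)] by blast
qed

lemma finite_separators_between_block_verts: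
  assumes "block_verts B" "block_verts B'"
  shows "finite (separators_between B B')"
proof -
  obtain A where A: "A \<subseteq> B" "finite A"
    "\<forall>C. inseparable C \<longrightarrow> separators_between B C \<subseteq> separators_between A C"
    using block_verts_finite_witness[OF assms(1)] .
  obtain A' where A': "A' \<subseteq> B'" "finite A'"
    "\<forall>C. inseparable C \<longrightarrow> separators_between B' C \<subseteq> separators_between A' C"
    using block_verts_finite_witness[OF assms(2)] .
  have ins: "inseparable B'" "inseparable A"
    using assms A(1) block_vertsD(2) inseparable_subset by blast+
  have "separators_between B B' \<subseteq> separators_between A B'" using A(3) ins(1) by blast
  also have "\<dots> \<subseteq> separators_between A A'"
    using A'(3) ins(2) separators_between_commute[of A] by auto
  finally show ?thesis
    using finite_separators_between A(1,2) A'(1,2) assms block_vertsD(3)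
    by (meson finite_subset order_trans)
qed

lemma separator_in_block_verts:
  assumes "separator X" "c \<in> V - X"
  obtains B w where "block_verts B" "X \<subseteq> B" "w \<in> B" "(c, w) \<in> linked X"
proof -
  obtain w where w: "(c, w) \<in> linked X" "inseparable (insert w X)"
    using separator_extends_into_component[OF assms] .
  have "w \<notin> X" using w linked_in_verts by blast
  then have "t < card (insert w X)" using separatorD[OF assms(1)] by simp
  then obtain B where "insert w X \<subseteq> B" "block_verts B"
    using block_verts_extend[OF w(2)] by blast
  then show ?thesis using that w(1) by blast
qed

lemma separators_between_psubset_same_side:
  assumes B: "block_verts B" "block_verts B'" "block_verts B1"
    and X: "X \<in> separators_between B B'" "X \<subseteq> B1"
    and linked: "u \<in> B" "w \<in> B1" "(u, w) \<in> linked X"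
  shows "separators_between B B1 \<subset> separators_between B B'"
proof
  note ins = B[THEN block_vertsD(2)]
  show "separators_between B B1 \<subseteq> separators_between B B'"
  proof
    fix Y assume Y: "Y \<in> separators_between B B1"
    then have sep: "separator Y" by (rule separators_between_separator)
    obtain b b' where b: "b \<in> B - Y" "b' \<in> B' - Y"
      using block_verts_not_subset_separator[OF _ sep] B(1,2) by blast
    have "(b, x) \<notin> linked Y" if "x \<in> X" for x
      using separators_between_not_linked[OF ins(1,3) Y] b(1) X(2) that by blast
    then have "(b, b') \<notin> linked Y"
      using linked_avoiding separators_between_not_linked[OF ins(1,2) X(1)] b by blast
    then show "Y \<in> separators_between B B'" using sep b by (auto simp: separators_between_def)
  qed
  have "X \<notin> separators_between B B1"
    using separators_between_not_linked[OF ins(1,3)] linked by blast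
  then show "separators_between B B1 \<noteq> separators_between B B'" using X(1) by blast
qed

lemma block_verts_split:
  assumes B: "block_verts B" "block_verts B'" "B \<noteq> B'"
  obtains X B1 B2 where "separator X" "block_verts B1" "block_verts B2" "X \<subseteq> B1" "X \<subseteq> B2"
    "separators_between B B1 \<subset> separators_between B B'"
    "separators_between B2 B' \<subset> separators_between B B'"
proof -
  obtain X where X: "X \<in> separators_between B B'"
    using separators_between_block_verts_nonempty[OF B] by blast
  then have sep: "separator X" by (rule separators_between_separator)
  obtain u v where uv: "u \<in> B - X" "v \<in> B' - X"
    using block_verts_not_subset_separator[OF _ sep] B(1,2) by blast
  then have V: "u \<in> V - X" "v \<in> V - X" using block_vertsD(3) B(1,2) by auto
  obtain B1 w1 where B1: "block_verts B1" "X \<subseteq> B1" "w1 \<in> B1" "(u, w1) \<in> linked X"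
    using separator_in_block_verts[OF sep V(1)] .
  obtain B2 w2 where B2: "block_verts B2" "X \<subseteq> B2" "w2 \<in> B2" "(v, w2) \<in> linked X"
    using separator_in_block_verts[OF sep V(2)] .
  have "separators_between B B1 \<subset> separators_between B B'"
    using separators_between_psubset_same_side[OF B(1,2) B1(1) X] B1 uv by blast
  moreover have "X \<in> separators_between B' B" using X by (simp add: separators_between_commute)
  then have "separators_between B' B2 \<subset> separators_between B' B"
    using separators_between_psubset_same_side[OF B(2,1) B2(1)] B2 uv by blast
  then have "separators_between B2 B' \<subset> separators_between B B'"
    by (simp add: separators_between_commute)
  ultimately show ?thesis using that sep B1(1,2) B2(1,2) by blast
qed

lemma block_verts_sharing_separator_not_linked:
  assumes B: "block_verts B" "block_verts B'" "B \<noteq> B'" and X: "separator X" "X \<subseteq> B \<inter> B'"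
    and "u \<in> B" "v \<in> B'"
  shows "(u, v) \<notin> linked X"
proof -
  note ins = B(1,2)[THEN block_vertsD(2)]
  obtain Y where Y: "Y \<in> separators_between B B'"
    using separators_between_block_verts_nonempty[OF B] by blast
  have "x \<in> Y" if "x \<in> X" for x
    using separators_between_not_linked[OF ins Y, of x x] that X(2) separatorD(1)[OF X(1)] by auto
  then have "X = Y"
    using subset_separator_eq[OF separators_between_separator[OF Y]] separatorD(3)[OF X(1)] by blast
  then show ?thesis using separators_between_not_linked[OF ins Y] assms by blast
qed

section \<open>Blocks are induced by their vertex sets\<close>

definition block_like :: "('a, 'a \<times> 'a) pre_digraph \<Rightarrow> bool" where
  "block_like H \<longleftrightarrow> symmetric H \<and> (complete_digraph (t + 1) H \<or> k_connected (t + 1) H)"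

lemma block_like_induced:
  assumes "block_verts B"
  shows "block_like (with_proj G \<restriction> B)"
proof -
  have max: "max_inseparable B" using assms by (rule block_vertsD)
  have "complete_digraph (t + 1) (with_proj G \<restriction> B) \<or> k_connected (t + 1) (with_proj G \<restriction> B)"
  proof (cases "infinite B \<or> t + 1 < card B")
    case True
    have "connected (delete_verts (with_proj G \<restriction> B) S)"
      if S: "S \<subseteq> B" "finite S" "card S < t + 1" for S
    proof -
      have "B \<noteq> S" using S assms by (auto simp: block_verts_def)
      moreover have "(u, v) \<in> rtrancl_on (B - S) E" if "u \<in> B - S" "v \<in> B - S" for u v
        using max_inseparable_connected[OF max S(1,2) _ that] S(3) by simp
      ultimately show ?thesis
        using S(1) connected_induce_subgraph_iff[OF wf_digraph_axioms pair_sym_arcs]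
        by (auto simp: delete_verts_induce_subgraph)
    qed
    then show ?thesis using True by (auto simp: k_connected_def)
  next
    case False
    then have card: "finite B" "card B = Suc t" using assms by (auto simp: block_verts_def)
    then have "parcs (induced B) = {(u, v). (u, v) \<in> B \<times> B \<and> u \<noteq> v}"
      using max_inseparable_card_Suc_clique[OF max] no_loops' by (auto simp: induced_def)
    then show ?thesis
      using card complete_digraph_pair_def[of "t + 1" "induced B"] by (simp add: with_proj_induced)
  qed
  then show ?thesis
    using symmetric_induce_subgraph[OF pair_sym_arcs] by (simp add: block_like_def)
qed

lemma block_like_verts_inseparable:
  assumes "subgraph H (with_proj G)" "block_like H"
  shows "inseparable (verts H)"
proof -
  have wf: "wf_digraph H" and sub: "verts H \<subseteq> V" and sym: "symmetric H"
    using assms by (auto simp: subgraph_def block_like_def)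
  have arcs: "arcs_ends H \<subseteq> E" using arcs_ends_mono[OF assms(1)] by simp
  from assms(2) consider "complete_digraph (t + 1) H" | "k_connected (t + 1) H"
    by (auto simp: block_like_def)
  then show ?thesis
  proof cases
    case 1
    then have "arcs_ends H = {(u, v). (u, v) \<in> verts H \<times> verts H \<and> u \<noteq> v}"
      by (simp add: complete_digraph_def)
    then show ?thesis using arcs sub by (intro inseparable_clique) auto
  next
    case 2
    have "(u, v) \<in> linked X"
      if X: "separator X" and uv: "u \<in> verts H - X" "v \<in> verts H - X" for X u v
    proof -
      have "card (X \<inter> verts H) < t + 1" "finite (X \<inter> verts H)"
        using separatorD[OF X] card_mono[of X "X \<inter> verts H"] by auto
      then have "connected (delete_verts H (X \<inter> verts H))"
        using 2 by (auto simp: k_connected_def)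
      moreover have "verts H - X \<inter> verts H = verts H - X" by blast
      ultimately have "(u, v) \<in> rtrancl_on (verts H - X) (arcs_ends H)"
        using connected_induce_subgraph_iff[OF wf sym] uv by (simp add: delete_verts_def)
      then show ?thesis
        using sub by (intro rtrancl_on_mono[OF arcs, of "verts H - X"]) auto
    qed
    then show ?thesis using sub by (auto simp: inseparable_def separators_between_def)
  qed
qed

lemma block_like_card: "block_like H \<Longrightarrow> infinite (verts H) \<or> t < card (verts H)"
  by (auto simp: block_like_def complete_digraph_def k_connected_def)

lemma max_subgraph_block_like_induced:
  assumes "block_verts B"
  shows "max_subgraph block_like (with_proj G \<restriction> B)"
proof (rule max_subgraphI)
  show "block_like (with_proj G \<restriction> B)" using assms by (rule block_like_induced)
  show "subgraph (with_proj G \<restriction> B) (with_proj G)"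
    using block_vertsD(3)[OF assms] subgraph_induce_subgraphI by simp
next
  fix H
  assume H: "with_proj G \<restriction> B \<noteq> H" "subgraph (with_proj G \<restriction> B) H" "subgraph H (with_proj G)"
  show "\<not> block_like H"
  proof
    assume "block_like H"
    then have "inseparable (verts H)" using H(3) by (intro block_like_verts_inseparable)
    moreover have "B \<subseteq> verts H" using subgraph_imp_subverts[OF H(2)] by simp
    ultimately have "verts H = B" using block_vertsD(1)[OF assms] by (simp add: max_inseparable_def)
    then have "subgraph H (with_proj G \<restriction> B)"
      using subgraph_induce_subgraphI2[OF H(3)] by simp
    then show False using subgraph_antisym H(1,2) by blast
  qed
qed

lemma max_subgraph_block_likeE:
  assumes "max_subgraph block_like H"
  obtains B where "block_verts B" "H = with_proj G \<restriction> B"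
proof -
  have H: "subgraph H (with_proj G)" "block_like H"
    using assms by (auto simp: max_subgraph_def)
  obtain B where B: "verts H \<subseteq> B" "block_verts B"
    using block_verts_extend[OF block_like_verts_inseparable[OF H] block_like_card[OF H(2)]] .
  have "H = with_proj G \<restriction> B"
    using assms max_subgraph_block_like_induced[OF B(2)]
      subgraph_induce_subgraphI_superset[OF H(1) B(1)]
    by (rule max_subgraph_subg_eq)
  then show ?thesis using that B(2) by blast
qed

lemma block_iff: "block (t + 1) G D \<longleftrightarrow> (\<exists>B. block_verts B \<and> D = induced B)"
proof -
  have "block (t + 1) G D \<longleftrightarrow> max_subgraph block_like (with_proj D)"
    by (simp add: block_def block_like_def[abs_def])
  also have "\<dots> \<longleftrightarrow> (\<exists>B. block_verts B \<and> with_proj D = with_proj G \<restriction> B)"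
    using max_subgraph_block_likeE max_subgraph_block_like_induced by metis
  finally show ?thesis by (simp add: with_proj_induced[symmetric] with_proj_inject)
qed

section \<open>The block-separator graph\<close>

abbreviation T :: "('a pair_pre_digraph + 'a set) pair_pre_digraph" where
  "T \<equiv> block_separator_graph t G"

definition bag :: "'a pair_pre_digraph + 'a set \<Rightarrow> 'a set" where
  "bag = case_sum pverts id"

lemma bag_simps [simp]: "bag (Inl D) = pverts D" "bag (Inr X) = X"
  by (simp_all add: bag_def)

lemma Inl_in_T: "Inl D \<in> pverts T \<longleftrightarrow> (\<exists>B. block_verts B \<and> D = induced B)"
  unfolding block_iff[symmetric] by (auto simp: block_separator_graph_def)

lemma Inr_in_T: "Inr X \<in> pverts T \<longleftrightarrow> separator X"
  by (auto simp: block_separator_graph_def)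

lemma T_arc_iff:
  "(a, b) \<in> parcs T \<longleftrightarrow> (\<exists>B X. block_verts B \<and> separator X \<and> X \<subseteq> B \<and>
    (a = Inl (induced B) \<and> b = Inr X \<or> a = Inr X \<and> b = Inl (induced B)))"
proof -
  have "(a, b) \<in> parcs T \<longleftrightarrow> (\<exists>D X. block (t + 1) G D \<and> separator X \<and> X \<subseteq> pverts D \<and>
    (a = Inl D \<and> b = Inr X \<or> a = Inr X \<and> b = Inl D))"
    by (auto simp: block_separator_graph_def)
  then show ?thesis unfolding block_iff by (metis pverts_induced)
qed

lemma pair_bidirected_T: "pair_bidirected_digraph T"
proof
  show "symmetric (with_proj T)"
    unfolding symmetric_def with_proj_simps by (rule symI) (metis T_arc_iff)
next
  fix e assume "e \<in> parcs T"
  then have "(fst e, snd e) \<in> parcs T" by simp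
  then show "fst e \<in> pverts T" "snd e \<in> pverts T" "fst e \<noteq> snd e"
    unfolding T_arc_iff by (auto simp: Inl_in_T Inr_in_T)
qed

interpretation T: pair_bidirected_digraph T
  by (rule pair_bidirected_T)

lemma blocks_linked_in_T:
  assumes "block_verts B" "block_verts B'"
  shows "(Inl (induced B), Inl (induced B')) \<in> T.linked {}"
  using assms
proof (induct "card (separators_between B B')" arbitrary: B B' rule: less_induct)
  case less
  have fin: "finite (separators_between B B')"
    using less.prems by (rule finite_separators_between_block_verts)
  show ?case
  proof (cases "B = B'")
    case True
    then show ?thesis using less.prems by (auto simp: Inl_in_T)
  next
    case False
    with less.prems obtain X B1 B2 where X: "separator X" "block_verts B1" "block_verts B2"
      "X \<subseteq> B1" "X \<subseteq> B2" "separators_between B B1 \<subset> separators_between B B'"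
      "separators_between B2 B' \<subset> separators_between B B'"
      by (rule block_verts_split)
    have "(Inl (induced B), Inl (induced B1)) \<in> T.linked {}"
      using less.hyps[OF psubset_card_mono[OF fin X(6)]] less.prems X(2) by blast
    moreover have "(Inl (induced B1), Inr X) \<in> parcs T" "(Inr X, Inl (induced B2)) \<in> parcs T"
      using X by (auto simp: T_arc_iff)
    then have "(Inl (induced B1), Inr X) \<in> T.linked {}" "(Inr X, Inl (induced B2)) \<in> T.linked {}"
      by (blast intro: T.linked_edge)+
    moreover have "(Inl (induced B2), Inl (induced B')) \<in> T.linked {}"
      using less.hyps[OF psubset_card_mono[OF fin X(7)]] less.prems X(3) by blast
    ultimately show ?thesis using T.linked_trans by blast
  qed
qed

lemma linked_to_block_in_T:
  assumes "a \<in> pverts T"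
  obtains B where "block_verts B" "(a, Inl (induced B)) \<in> T.linked {}"
proof (cases a)
  case (Inl D)
  then obtain B where "block_verts B" "D = induced B" using assms by (auto simp: Inl_in_T)
  then show ?thesis using that[of B] assms Inl by auto
next
  case (Inr X)
  then have X: "separator X" using assms by (simp add: Inr_in_T)
  obtain B where B: "block_verts B" "X \<subseteq> B"
    using separator_proper[OF X] separator_in_block_verts[OF X] by metis
  then have "(a, Inl (induced B)) \<in> parcs T" using Inr X by (auto simp: T_arc_iff)
  then show ?thesis using that[OF B(1)] by (blast intro: T.linked_edge)
qed

lemma pverts_T_nonempty: "pverts T \<noteq> {}"
proof (cases "\<exists>X. separator X")
  case True
  then show ?thesis using Inr_in_T by blast
next
  case False
  then have "inseparable V" by (auto simp: inseparable_def separators_between_def)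
  moreover have "infinite V \<or> t < card V"
    using cleavage by (auto simp: cleavage_property_def k_connected_def)
  ultimately obtain B where "block_verts B" by (rule block_verts_extend)
  then show ?thesis using Inl_in_T by blast
qed

lemma connected_T: "connected (with_proj T)"
proof -
  have "(a, b) \<in> T.linked {}" if ab: "a \<in> pverts T" "b \<in> pverts T" for a b
  proof -
    obtain A where A: "block_verts A" "(a, Inl (induced A)) \<in> T.linked {}"
      using linked_to_block_in_T[OF ab(1)] .
    obtain B where B: "block_verts B" "(b, Inl (induced B)) \<in> T.linked {}"
      using linked_to_block_in_T[OF ab(2)] .
    show ?thesis
      using A(2) blocks_linked_in_T[OF A(1) B(1)] T.linked_sym[OF B(2)] T.linked_trans by blast
  qed
  then show ?thesis
    using connected_iff_rtrancl_on[OF T.wf_digraph_axioms T.pair_sym_arcs] pverts_T_nonempty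
    by simp
qed

lemma bag_inseparable: "a \<in> pverts T \<Longrightarrow> inseparable (bag a)"
  by (cases a) (auto simp: Inl_in_T Inr_in_T block_vertsD(2) separator_inseparable)

lemma T_arc_bags_meet_outside_separator:
  assumes "separator X" "(a, b) \<in> parcs T" "a \<noteq> Inr X" "b \<noteq> Inr X"
  shows "bag a \<inter> bag b - X \<noteq> {}"
proof -
  obtain B Y where Y: "separator Y" "Y \<subseteq> B"
    and ends: "a = Inl (induced B) \<and> b = Inr Y \<or> a = Inr Y \<and> b = Inl (induced B)"
    using assms(2) by (auto simp: T_arc_iff)
  have "bag a \<inter> bag b = Y" using ends Y(2) by auto
  moreover have "\<not> Y \<subseteq> X"
    using subset_separator_eq[OF assms(1)] separatorD(3)[OF Y(1)] ends assms(3,4) by blast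
  ultimately show ?thesis by blast
qed

lemma linked_in_T_imp_linked:
  assumes X: "separator X" and ab: "(a, b) \<in> T.linked {Inr X}"
    and uv: "u \<in> bag a - X" "v \<in> bag b - X"
  shows "(u, v) \<in> linked X"
  using ab uv(2)
proof (induct arbitrary: v rule: rtrancl_on_induct)
  case base
  then show ?case using uv(1) by (auto intro: inseparable_linked[OF bag_inseparable X])
next
  case (step b c)
  obtain w where w: "w \<in> bag b \<inter> bag c - X"
    using T_arc_bags_meet_outside_separator[OF X step.hyps(2)] step.hyps(3,4) by blast
  then have "(u, w) \<in> linked X" using step.hyps(5) by blast
  also have "(w, v) \<in> linked X"
    using w step.hyps(4) step.prems by (auto intro: inseparable_linked[OF bag_inseparable X])
  finally (linked_trans) show ?case .
qed

lemma cycle_in_T_through_separator: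
  assumes "T.cycle p" "3 \<le> length p"
  obtains X where "Inr X \<in> snd ` set p"
proof -
  obtain a b c q where p: "p = (a, b) # (b, c) # q" "set p \<subseteq> parcs T"
    using assms by (cases p rule: remdups_adj.cases)
      (auto simp: T.cycle_def T.awalk_def)
  then have "(a, b) \<in> parcs T" "(b, c) \<in> parcs T" by auto
  then have "\<exists>X. b = Inr X \<or> c = Inr X" by (auto simp: T_arc_iff)
  then show ?thesis using that p(1) by force
qed

lemma no_cycle_in_T: "\<not> (T.cycle p \<and> 3 \<le> length p)"
proof
  assume "T.cycle p \<and> 3 \<le> length p"
  then have p: "T.cycle p" "3 \<le> length p" by auto
  obtain X where "Inr X \<in> snd ` set p" using cycle_in_T_through_separator[OF p] .
  then obtain a b where ab: "(Inr X, a) \<in> parcs T" "(Inr X, b) \<in> parcs T" "a \<noteq> b"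
    "(a, b) \<in> T.linked {Inr X}"
    using T.cycle_neighbours_linked[OF p] by metis
  obtain A B where A: "a = Inl (induced A)" "block_verts A" "X \<subseteq> A"
    and B: "b = Inl (induced B)" "block_verts B" "X \<subseteq> B" and X: "separator X"
    using ab(1,2) by (auto simp: T_arc_iff)
  obtain u v where uv: "u \<in> A - X" "v \<in> B - X"
    using block_verts_not_subset_separator A(2) B(2) X by blast
  have "(u, v) \<in> linked X" using linked_in_T_imp_linked[OF X ab(4)] A(1) B(1) uv by simp
  moreover have "(u, v) \<notin> linked X"
    using block_verts_sharing_separator_not_linked[OF A(2) B(2) _ X] ab(3) A B uv by blast
  ultimately show False by blast
qed

end

theorem theorem4p2:
  fixes t :: nat and G :: "'a pair_pre_digraph"
  assumes "1 \<le> t"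
    and "pair_bidirected_digraph G"
    and "cleavage_property t (with_proj G)"
  shows "undirected_tree (block_separator_graph t G)"
proof -
  interpret cleavage_graph G t
    using assms by (simp add: cleavage_graph_def cleavage_graph_axioms_def)
  show ?thesis
    using pair_bidirected_T connected_T no_cycle_in_T by (simp add: undirected_tree_def)
qed

end
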